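(* For any $m\in\mathbb N$, the class of $m$-uniform safe undominated bidding strategies is $$\overline{\mathcal P}_m=\Big\{\mathbf b=\langle(b_1,q_1),\dots,(b_m,q_m)\rangle:\ b_\ell=w_{Q_\ell}\ \text{for all }\ell\in[m]\Big\}.$$
   Context: A uniform price auction sells $K$ identical units. A fixed bidder has valuation vector $\mathbf v=(v_1,\dots,v_M)$ with $v_1\ge\dots\ge v_M>0$, $M\le K$. Define $w_j=\frac1j\sum_{\ell\le j}v_\ell$. An $m$-uniform bidding strategy is $\mathbf b=\langle(b_1,q_1),\dots,(b_m,q_m)\rangle$ with $b_1>\dots>b_m>0$, positive integers $q_j$, $Q_j=\sum_{\ell\le j}q_\ell$, $Q_m\le M$; it stands for the bid vector with $q_1$ copies of $b_1$, then $q_2$ copies of $b_2$, etc. Given competing bids $\boldsymbol\beta_-$ of the other bidders, the $K$ highest of all bids win one unit each (ties broken in favor of the bidder); the allocation $x$ is the number of the bidder's winning bids, the per-unit price $p$ is the $K$-th highest bid, $V(\mathbf b;\boldsymbol\beta_-)=\sum_{j\le x}v_j$ and $P(\mathbf b;\boldsymbol\beta_-)=p x$. $\mathbf b$ is safe if $V(\mathbf b;\boldsymbol\beta_-)\ge P(\mathbf b;\boldsymbol\beta_-)$ for every $\boldsymbol\beta_-$; $\mathcal P_m$ denotes the class of $m$-uniform safe strategies. A safe strategy $\mathbf b$ is very weakly dominated if there is another safe strategy $\mathbf b'$ with $V(\mathbf b;\boldsymbol\beta_-)\le V(\mathbf b';\boldsymbol\beta_-)$ for all $\boldsymbol\beta_-$;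 the class of $m$-uniform safe undominated strategies is the subclass of $\mathcal P_m$ obtained by eliminating very weakly dominated strategies.
   Formalization: Equality is proved when v_1 > v_2 (or M = 1); for v_1 = v_2 it fails (v=(1,1), m=1: ⟨(1,1)⟩ is dominated by ⟨(1,2)⟩) and only the inclusion of the undominated class in the displayed set is claimed. Dominating strategies are taken from the same class P_m. *)

theory Defs
  imports Complex_Main
begin

text \<open>Valuations are functions on \<open>nat\<close> of which only the values at \<open>1, \<dots>, M\<close> matter.\<close>

definition avg_val :: "(nat \<Rightarrow> real) \<Rightarrow> nat \<Rightarrow> real" where
  "avg_val v j = (\<Sum>l = 1..j. v l) / real j"

type_synonym strategy = "(real \<times> nat) list"

definition cum_qty :: "strategy \<Rightarrow> nat \<Rightarrow> nat" where
  "cum_qty b l = sum_list (map snd (take l b))"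

definition uniform_strategy :: "nat \<Rightarrow> nat \<Rightarrow> strategy \<Rightarrow> bool" where
  "uniform_strategy M m b \<longleftrightarrow>
     length b = m \<and>
     sorted_wrt (>) (map fst b) \<and>
     (\<forall>(p, q) \<in> set b. 0 < p \<and> 0 < q) \<and>
     cum_qty b m \<le> M"

definition bid_vector :: "strategy \<Rightarrow> real list" where
  "bid_vector b = concat (map (\<lambda>(p, q). replicate q p) b)"

text \<open>All bids in decreasing order, tagged with \<open>True\<close> if they belong to the bidder.
  The function \<open>sort_key\<close> is stable, so listing the bidder's own bids first
  breaks ties in favour of the bidder.\<close>

definition ranking :: "strategy \<Rightarrow> real list \<Rightarrow> (real \<times> bool) list" where
  "ranking b \<beta> = sort_key (\<lambda>(p, own). - p)
     (map (\<lambda>p. (p, True)) (bid_vector b) @ map (\<lambda>p. (p, False)) \<beta>)"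

definition allocation :: "nat \<Rightarrow> strategy \<Rightarrow> real list \<Rightarrow> nat" where
  "allocation K b \<beta> = length (filter snd (take K (ranking b \<beta>)))"

text \<open>If there are fewer than \<open>K\<close> bids in total, the \<open>K\<close>-th highest bid is taken to be \<open>0\<close>.\<close>

definition price :: "nat \<Rightarrow> strategy \<Rightarrow> real list \<Rightarrow> real" where
  "price K b \<beta> = (if K \<le> length (ranking b \<beta>) then fst (ranking b \<beta> ! (K - 1)) else 0)"

definition value_won :: "nat \<Rightarrow> (nat \<Rightarrow> real) \<Rightarrow> strategy \<Rightarrow> real list \<Rightarrow> real" where
  "value_won K v b \<beta> = (\<Sum>j = 1..allocation K b \<beta>. v j)"

definition payment :: "nat \<Rightarrow> strategy \<Rightarrow> real list \<Rightarrow> real" where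
  "payment K b \<beta> = price K b \<beta> * real (allocation K b \<beta>)"

text \<open>Competing bids: any finite number of non-negative bids, in any order.\<close>

definition competing_bids :: "real list set" where
  "competing_bids = {\<beta>. \<forall>c \<in> set \<beta>. 0 \<le> c}"

definition safe :: "nat \<Rightarrow> (nat \<Rightarrow> real) \<Rightarrow> strategy \<Rightarrow> bool" where
  "safe K v b \<longleftrightarrow> (\<forall>\<beta> \<in> competing_bids. payment K b \<beta> \<le> value_won K v b \<beta>)"

definition safe_class :: "nat \<Rightarrow> nat \<Rightarrow> (nat \<Rightarrow> real) \<Rightarrow> nat \<Rightarrow> strategy set" where
  "safe_class K M v m = {b. uniform_strategy M m b \<and> safe K v b}"

definition very_weakly_dominated ::
  "nat \<Rightarrow> (nat \<Rightarrow> real) \<Rightarrow> strategy set \<Rightarrow> strategy \<Rightarrow> bool" where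
  "very_weakly_dominated K v S b \<longleftrightarrow>
     (\<exists>b' \<in> S. b' \<noteq> b \<and> (\<forall>\<beta> \<in> competing_bids. value_won K v b \<beta> \<le> value_won K v b' \<beta>))"

text \<open>The dominating strategy ranges over the same class of \<open>m\<close>-uniform strategies.
  (If strategies with more steps were allowed, any strategy with \<open>Q\<^sub>m < M\<close> and
  \<open>b\<^sub>l = w\<^bsub>Q\<^sub>l\<^esub>\<close> would be dominated as soon as \<open>w\<close> is strictly decreasing:
  append the step \<open>(w\<^bsub>M\<^esub>, M - Q\<^sub>m)\<close>.)\<close>

definition safe_undominated_class ::
  "nat \<Rightarrow> nat \<Rightarrow> (nat \<Rightarrow> real) \<Rightarrow> nat \<Rightarrow> strategy set" where
  "safe_undominated_class K M v m =
     {b \<in> safe_class K M v m. \<not> very_weakly_dominated K v (safe_class K M v m) b}"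

text \<open>Without any further condition on \<open>v\<close>, the two classes may differ when \<open>v 1 = v 2\<close>:
  for \<open>M = 2\<close>, \<open>v 1 = v 2 = 1\<close>, \<open>m = 1\<close>, the strategy \<open>[(1, 1)]\<close> belongs to
  \<open>average_class\<close>, but it is dominated by the safe strategy \<open>[(1, 2)]\<close>.\<close>

definition average_class :: "nat \<Rightarrow> (nat \<Rightarrow> real) \<Rightarrow> nat \<Rightarrow> strategy set" where
  "average_class M v m =
     {b. uniform_strategy M m b \<and>
         (\<forall>l \<in> {1..m}. fst (b ! (l - 1)) = avg_val v (cum_qty b l))}"

end

theory Submission
  imports Defs "HOL-Library.Multiset"
begin

text \<open>
  Against competing bids \<open>\<beta>\<close>, the bidder's \<open>j\<close>-th highest bid \<open>s\<^sub>j\<close> wins iff at most \<open>K - j\<close>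
  competing bids exceed it, and the price never exceeds the lowest winning own bid.
  Flooding the auction with \<open>K - Q\<^sub>l\<close> high bids makes the bidder win exactly \<open>Q\<^sub>l\<close> units
  at price \<open>b\<^sub>l\<close>; hence a strategy is safe iff \<open>b\<^sub>l \<le> w\<^bsub>Q\<^sub>l\<^esub>\<close> for all \<open>l\<close>.
  If one of these inequalities is strict, raising that single bid a little, staying below
  \<open>b\<^bsub>l - 1\<^esub>\<close>, gives a dominating safe strategy. Conversely, if all are equalities and \<open>b'\<close>
  dominates \<open>b\<close>, then adding \<open>Q\<^sub>l\<close> competing bids equal to \<open>b\<^sub>l\<close> to the flood shows that the
  \<open>Q\<^sub>l\<close>-th bid of \<open>b'\<close> is at least \<open>w\<^bsub>Q\<^sub>l\<^esub>\<close>. Since \<open>w\<close> is strictly decreasing and \<open>b'\<close> is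
  safe, \<open>Q\<^sub>l\<close> must be the end of a step of \<open>b'\<close>; both strategies have \<open>m\<close> steps, so they agree.
\<close>

section \<open>Rankings\<close>

text \<open>Taking an arbitrary list of own bids instead of a strategy lets inductions remove one
  bid at a time.\<close>

definition merged_bids :: "real list \<Rightarrow> real list \<Rightarrow> (real \<times> bool) list" where
  "merged_bids s \<beta> = sort_key (\<lambda>(p, own). - p)
     (map (\<lambda>p. (p, True)) s @ map (\<lambda>p. (p, False)) \<beta>)"

abbreviation count_above :: "real \<Rightarrow> real list \<Rightarrow> nat" where
  "count_above t xs \<equiv> length (filter (\<lambda>c. t < c) xs)"

lemma ranking_eq_merged_bids: "ranking b \<beta> = merged_bids (bid_vector b) \<beta>"
  by (simp add: ranking_def merged_bids_def)

text \<open>Insertion places \<open>x\<close> before all entries of equal key. With key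
  \<open>- p\<close> this is the tie-breaking rule: an own bid passes every competing bid that is
  not strictly higher.\<close>

lemma insort_key_eq_takeWhile_dropWhile:
  "insort_key f x xs = takeWhile (\<lambda>y. f y < f x) xs @ x # dropWhile (\<lambda>y. f y < f x) xs"
  by (induction xs) auto

lemma takeWhile_eq_filter_sorted_key:
  fixes f :: "'a \<Rightarrow> 'b::linorder"
  shows "sorted (map f xs) \<Longrightarrow> takeWhile (\<lambda>y. f y < a) xs = filter (\<lambda>y. f y < a) xs"
proof (induction xs)
  case (Cons x xs)
  show ?case
  proof (cases "f x < a")
    case False
    then have "filter (\<lambda>y. f y < a) xs = []"
      using Cons.prems by (fastforce simp: filter_empty_conv)
    then show ?thesis using False by simp
  qed (use Cons in auto)
qed simp

lemma length_filter_merged_bids: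
  "length (filter (\<lambda>y. P (fst y)) (merged_bids s \<beta>)) = length (filter P s) + length (filter P \<beta>)"
proof -
  have "length (filter (\<lambda>y. P (fst y)) (merged_bids s \<beta>)) =
        size (filter_mset (\<lambda>y. P (fst y)) (mset (merged_bids s \<beta>)))"
    by (simp flip: mset_filter)
  also have "\<dots> = size (mset (filter (\<lambda>y. P (fst y))
      (map (\<lambda>p. (p, True)) s @ map (\<lambda>p. (p, False)) \<beta>)))"
    by (simp add: merged_bids_def)
  also have "\<dots> = length (filter P s) + length (filter P \<beta>)"
    by (simp only: size_mset) (simp add: filter_map o_def)
  finally show ?thesis .
qed

lemma merged_bids_antimono:
  assumes "i \<le> j" "j < length (merged_bids s \<beta>)"
  shows "fst (merged_bids s \<beta> ! j) \<le> fst (merged_bids s \<beta> ! i)"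
proof -
  have "sorted (map (\<lambda>(p, own). - p) (merged_bids s \<beta>))"
    by (simp add: merged_bids_def)
  from sorted_nth_mono[OF this assms(1)] assms show ?thesis
    by (simp add: case_prod_beta)
qed

text \<open>As \<open>x\<close> is the highest own bid, exactly the competing bids strictly above it
  precede it. If they leave a slot, \<open>x\<close> takes one and the other own bids compete for
  the remaining \<open>K - 1\<close>; otherwise the first \<open>K\<close> places are all lost to
  competitors.\<close>

lemma own_wins_Cons:
  assumes "\<forall>y \<in> set s. y \<le> x"
  shows "length (filter snd (take K (merged_bids (x # s) \<beta>))) =
     (if count_above x \<beta> < K then Suc (length (filter snd (take (K - 1) (merged_bids s \<beta>)))) else 0)"
proof -
  let ?f = "\<lambda>(p::real, own::bool). - p"
  let ?R = "merged_bids s \<beta>"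
  define T where "T = takeWhile (\<lambda>y. ?f y < ?f (x, True)) ?R"
  define D where "D = dropWhile (\<lambda>y. ?f y < ?f (x, True)) ?R"
  have "merged_bids (x # s) \<beta> = insort_key ?f (x, True) ?R"
    by (simp add: merged_bids_def)
  then have ins: "merged_bids (x # s) \<beta> = T @ (x, True) # D"
    by (simp only: insort_key_eq_takeWhile_dropWhile T_def D_def)
  have R: "?R = T @ D"
    by (simp add: T_def D_def)
  have srt: "sorted (map ?f ?R)"
    by (simp add: merged_bids_def)
  have T: "T = filter (\<lambda>y. x < fst y) ?R"
    unfolding T_def using takeWhile_eq_filter_sorted_key[OF srt, of "?f (x, True)"]
    by (simp add: case_prod_beta)
  have "filter (\<lambda>c. x < c) s = []"
    using assms by (auto simp: filter_empty_conv)
  then have lenT: "length T = count_above x \<beta>"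
    using length_filter_merged_bids[of "\<lambda>p. x < p" s \<beta>] T by simp
  have "\<not> snd y" if "y \<in> set T" for y
    using that assms unfolding T by (auto simp: merged_bids_def)
  then have noown: "filter snd (take n T) = []" for n
    by (meson filter_False in_set_takeD)
  show ?thesis
  proof (cases "count_above x \<beta> < K")
    case True
    \<comment> \<open>Here \<open>d\<close> is the number of slots left after the block
      \<open>T\<close> and the bid \<open>x\<close>.\<close>
    then obtain d where d: "K = Suc (length T + d)"
      by (metis lenT less_iff_Suc_add)
    show ?thesis using True noown[of "length T"] unfolding ins R d by (simp add: lenT)
  next
    case False
    then show ?thesis using noown[of K] unfolding ins by (simp add: lenT)
  qed
qed

text \<open>Positions count from 0, so \<open>j\<close> own bids stand ahead of
  \<open>s ! j\<close>. The induction removes the highest own bid, which costs one slot and shifts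
  both \<open>j\<close> and \<open>K\<close> by one.\<close>

lemma less_own_wins_iff:
  assumes "sorted_wrt (\<ge>) s"
  shows "j < length (filter snd (take K (merged_bids s \<beta>))) \<longleftrightarrow>
     j < length s \<and> j + count_above (s ! j) \<beta> < K"
  using assms
proof (induction s arbitrary: j K)
  case Nil
  have "filter snd (take K (merged_bids [] \<beta>)) = []"
    by (auto simp: filter_empty_conv merged_bids_def dest!: in_set_takeD)
  then show ?case by simp
next
  case (Cons x s)
  have le: "\<forall>y \<in> set s. y \<le> x" and srt: "sorted_wrt (\<ge>) s"
    using Cons.prems by auto
  show ?case
  proof (cases j)
    case 0
    then show ?thesis by (simp add: own_wins_Cons[OF le])
  next
    case (Suc i)
    \<comment> \<open>A competing bid above \<open>x\<close> is also above the lower bid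
      \<open>s ! i\<close>, so a win of \<open>s ! i\<close> entails a win of
      \<open>x\<close>.\<close>
    have "count_above x \<beta> \<le> count_above (s ! i) \<beta>" if "i < length s"
    proof -
      have "s ! i \<le> x" using le that by simp
      then have "filter (\<lambda>c. x < c) \<beta> = filter (\<lambda>c. x < c) (filter (\<lambda>c. s ! i < c) \<beta>)"
        by (auto intro!: filter_cong)
      then show ?thesis by (metis length_filter_le)
    qed
    then show ?thesis
      using Suc Cons.IH[OF srt, of i "K - 1"] by (auto simp: own_wins_Cons[OF le])
  qed
qed

section \<open>Bounding the price by counting bids\<close>

text \<open>A price above \<open>t\<close> would put \<open>K\<close> bids above \<open>t\<close>.
  The condition \<open>0 \<le> t\<close> covers the default price 0 when fewer than \<open>K\<close>
  bids exist.\<close>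

lemma price_le:
  assumes "count_above t (bid_vector b) + count_above t \<beta> < K" "0 \<le> t"
  shows "price K b \<beta> \<le> t"
proof (rule ccontr)
  let ?R = "merged_bids (bid_vector b) \<beta>"
  assume "\<not> price K b \<beta> \<le> t"
  then have len: "K \<le> length ?R" and gt: "t < fst (?R ! (K - 1))"
    using assms(2) by (auto simp: price_def ranking_eq_merged_bids split: if_splits)
  have "t < fst (?R ! i)" if "i < K" for i
    using merged_bids_antimono[of i "K - 1" "bid_vector b" \<beta>] that len gt by linarith
  then have "{..<K} \<subseteq> {i. i < length ?R \<and> t < fst (?R ! i)}"
    using len by auto
  then have "K \<le> card {i. i < length ?R \<and> t < fst (?R ! i)}"
    using card_mono[of "{i. i < length ?R \<and> t < fst (?R ! i)}" "{..<K}"] by simp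
  also have "\<dots> = length (filter (\<lambda>y. t < fst y) ?R)"
    by (simp add: length_filter_conv_card)
  finally show False
    using assms(1) by (simp add: length_filter_merged_bids)
qed

text \<open>The \<open>K\<close> bids counted ensure that a \<open>K\<close>-th highest bid exists,
  so the default price 0 does not arise; antitonicity of the ranking then bounds that bid.\<close>

lemma price_ge:
  assumes "K \<le> length (filter (\<lambda>c. t \<le> c) (bid_vector b)) + length (filter (\<lambda>c. t \<le> c) \<beta>)"
    and "1 \<le> K"
  shows "t \<le> price K b \<beta>"
proof (rule ccontr)
  let ?R = "merged_bids (bid_vector b) \<beta>"
  let ?I = "{i. i < length ?R \<and> t \<le> fst (?R ! i)}"
  have cnt: "K \<le> card ?I"
    using assms(1) length_filter_merged_bids[of "\<lambda>c. t \<le> c" "bid_vector b" \<beta>]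
    by (simp add: length_filter_conv_card)
  have "card ?I \<le> card {..<length ?R}"
    by (rule card_mono) auto
  then have len: "K \<le> length ?R" using cnt by simp
  assume "\<not> t \<le> price K b \<beta>"
  then have lt: "fst (?R ! (K - 1)) < t"
    using len by (simp add: price_def ranking_eq_merged_bids)
  have "i < K - 1" if "i \<in> ?I" for i
    using merged_bids_antimono[of "K - 1" i "bid_vector b" \<beta>] that lt by force
  then have "?I \<subseteq> {..<K - 1}" by auto
  then have "card ?I \<le> K - 1"
    using card_mono[of "{..<K - 1}" ?I] by simp
  then show False using cnt assms(2) by linarith
qed

section \<open>Uniform strategies\<close>

lemma cum_qty_Suc: "l < length b \<Longrightarrow> cum_qty b (Suc l) = cum_qty b l + snd (b ! l)"
  by (simp add: cum_qty_def take_Suc_conv_app_nth)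

lemma cum_qty_Cons_Suc: "cum_qty (x # b) (Suc l) = snd x + cum_qty b l"
  by (simp add: cum_qty_def)

lemma cum_qty_0 [simp]: "cum_qty b 0 = 0"
  by (simp add: cum_qty_def)

lemma bid_vector_Cons: "bid_vector (x # b) = replicate (snd x) (fst x) @ bid_vector b"
  by (simp add: bid_vector_def case_prod_beta)

lemma length_bid_vector: "length (bid_vector b) = cum_qty b (length b)"
  by (induction b) (auto simp: bid_vector_Cons cum_qty_Cons_Suc, simp add: bid_vector_def)

text \<open>Steps count from 0 while \<open>cum_qty\<close> counts completed steps, so step
  \<open>l\<close> ends just before position \<open>cum_qty b (Suc l)\<close>. This shift recurs
  throughout.\<close>

lemma nth_bid_vector:
  assumes "l < length b" "cum_qty b l \<le> j" "j < cum_qty b (Suc l)"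
  shows "bid_vector b ! j = fst (b ! l)"
  using assms
proof (induction b arbitrary: l j)
  case (Cons x b)
  show ?case
  proof (cases l)
    case 0
    then show ?thesis using Cons.prems by (simp add: bid_vector_Cons cum_qty_Cons_Suc nth_append)
  next
    case (Suc k)
    then show ?thesis using Cons.prems Cons.IH[of k "j - snd x"]
      by (auto simp: bid_vector_Cons cum_qty_Cons_Suc nth_append)
  qed
qed simp

lemma bid_vector_step:
  assumes "j < length (bid_vector b)"
  obtains l where "l < length b" "cum_qty b l \<le> j" "j < cum_qty b (Suc l)"
proof -
  \<comment> \<open>Since \<open>cum_qty b 0 = 0\<close>, the least such \<open>n\<close> is
    positive; its predecessor is the step containing position \<open>j\<close>.\<close>
  define n where "n = (LEAST n. j < cum_qty b n)"
  have j: "j < cum_qty b (length b)" using assms by (simp add: length_bid_vector)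
  have n: "j < cum_qty b n" unfolding n_def by (rule LeastI) (rule j)
  have "n \<le> length b" unfolding n_def by (rule Least_le) (rule j)
  moreover obtain l where l: "n = Suc l" using n by (cases n) auto
  moreover have "\<not> j < cum_qty b l"
    using not_less_Least[of l "\<lambda>n. j < cum_qty b n"] l by (simp add: n_def)
  ultimately show ?thesis using that[of l] n by simp
qed

lemma cum_qty_mono: "k \<le> l \<Longrightarrow> cum_qty b k \<le> cum_qty b l"
  by (metis cum_qty_def le_add1 le_Suc_ex map_append sum_list_append take_add)

lemma
  assumes "uniform_strategy M m b"
  shows uniform_length: "length b = m"
    and uniform_pos: "l < m \<Longrightarrow> 0 < fst (b ! l)"
    and uniform_qty_pos: "l < m \<Longrightarrow> 0 < snd (b ! l)"
    and uniform_cum_qty_le: "cum_qty b l \<le> M"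
    and uniform_decreasing: "k < l \<Longrightarrow> l < m \<Longrightarrow> fst (b ! l) < fst (b ! k)"
proof -
  show len: "length b = m" using assms by (simp add: uniform_strategy_def)
  show "l < m \<Longrightarrow> 0 < fst (b ! l)" "l < m \<Longrightarrow> 0 < snd (b ! l)"
    using assms len nth_mem[of l b] by (auto simp: uniform_strategy_def case_prod_beta)
  show "cum_qty b l \<le> M"
  proof (cases "l \<le> m")
    case True
    then show ?thesis using assms cum_qty_mono[of l m b] by (simp add: uniform_strategy_def)
  next
    case False
    then have "cum_qty b l = cum_qty b m" using len by (simp add: cum_qty_def)
    then show ?thesis using assms by (simp add: uniform_strategy_def)
  qed
  show "k < l \<Longrightarrow> l < m \<Longrightarrow> fst (b ! l) < fst (b ! k)"
    using assms len by (auto simp: uniform_strategy_def sorted_wrt_iff_nth_less)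
qed

lemma uniform_cum_qty_less:
  assumes "uniform_strategy M m b" "k < l" "l \<le> m"
  shows "cum_qty b k < cum_qty b l"
proof -
  have "cum_qty b k < cum_qty b (Suc k)"
    using assms uniform_qty_pos[of M m b k] uniform_length[of M m b] by (simp add: cum_qty_Suc)
  also have "\<dots> \<le> cum_qty b l" using assms by (intro cum_qty_mono) simp
  finally show ?thesis .
qed

lemma bid_vector_last_of_step:
  assumes "uniform_strategy M m b" "l < m"
  shows "bid_vector b ! (cum_qty b (Suc l) - 1) = fst (b ! l)"
  using assms uniform_cum_qty_less[OF assms(1), of l "Suc l"] uniform_length[OF assms(1)]
  by (intro nth_bid_vector) auto

lemma uniform_bid_vector_sorted:
  assumes "uniform_strategy M m b"
  shows "sorted_wrt (\<ge>) (bid_vector b)"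
  unfolding sorted_wrt_iff_nth_less
proof (intro allI impI)
  fix i j assume ij: "i < j" "j < length (bid_vector b)"
  then have "i < length (bid_vector b)" by simp
  then obtain k where k: "k < length b" "cum_qty b k \<le> i" "i < cum_qty b (Suc k)"
    by (rule bid_vector_step)
  obtain l where l: "l < length b" "cum_qty b l \<le> j" "j < cum_qty b (Suc l)"
    using bid_vector_step[OF ij(2)] .
  have "\<not> l < k"
    using cum_qty_mono[of "Suc l" k b] k l ij by auto
  then have "fst (b ! l) \<le> fst (b ! k)"
    using uniform_decreasing[OF assms, of k l] l uniform_length[OF assms] by fastforce
  then show "bid_vector b ! j \<le> bid_vector b ! i"
    using nth_bid_vector[OF k] nth_bid_vector[OF l] by simp
qed

lemma uniform_bid_vector_antimono:
  assumes "uniform_strategy M m b" "i \<le> j" "j < length (bid_vector b)"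
  shows "bid_vector b ! j \<le> bid_vector b ! i"
  using uniform_bid_vector_sorted[OF assms(1)] assms(2,3)
  by (cases "i = j") (auto simp: sorted_wrt_iff_nth_less)

section \<open>Allocation and price of uniform strategies\<close>

lemma less_allocation_iff:
  assumes "uniform_strategy M m b"
  shows "j < allocation K b \<beta> \<longleftrightarrow>
    j < length (bid_vector b) \<and> j + count_above (bid_vector b ! j) \<beta> < K"
  unfolding allocation_def ranking_eq_merged_bids
  by (rule less_own_wins_iff[OF uniform_bid_vector_sorted[OF assms]])

lemma allocation_le:
  assumes "uniform_strategy M m b"
  shows "allocation K b \<beta> \<le> M"
proof -
  have "allocation K b \<beta> \<le> length (bid_vector b)"
    using less_allocation_iff[OF assms, of "length (bid_vector b)" K \<beta>] by simp
  also have "\<dots> \<le> M" using uniform_cum_qty_le[OF assms] by (simp add: length_bid_vector)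
  finally show ?thesis .
qed

text \<open>At most \<open>j\<close> own bids exceed the bid at position \<open>j\<close>, and since
  that bid wins, fewer than \<open>K - j\<close> competing bids do. So fewer than \<open>K\<close>
  bids exceed it in total.\<close>

lemma price_le_last_winning_bid:
  assumes "uniform_strategy M m b" "allocation K b \<beta> = Suc j"
  shows "price K b \<beta> \<le> bid_vector b ! j"
proof (rule price_le)
  let ?s = "bid_vector b"
  have j: "j < length ?s" "j + count_above (?s ! j) \<beta> < K"
    using less_allocation_iff[OF assms(1), of j K \<beta>] assms(2) by auto
  have "{i. i < length ?s \<and> ?s ! j < ?s ! i} \<subseteq> {..<j}"
    using uniform_bid_vector_antimono[OF assms(1), of j] by (force simp: not_less[symmetric])
  then have "count_above (?s ! j) ?s \<le> j"
    using card_mono[of "{..<j}" "{i. i < length ?s \<and> ?s ! j < ?s ! i}"]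
    by (simp add: length_filter_conv_card)
  then show "count_above (?s ! j) ?s + count_above (?s ! j) \<beta> < K"
    using j by linarith
  obtain l where l: "l < length b" "cum_qty b l \<le> j" "j < cum_qty b (Suc l)"
    using bid_vector_step[OF j(1)] .
  then show "0 \<le> ?s ! j"
    using nth_bid_vector[OF l] uniform_pos[OF assms(1), of l] uniform_length[OF assms(1)] by simp
qed

section \<open>Safety and domination\<close>

context
  fixes M :: nat and v :: "nat \<Rightarrow> real"
  assumes anti: "antimono_on {1..M} v" and vpos: "0 < v M"
begin

section \<open>Averages and partial sums of a decreasing valuation\<close>

lemma val_antimono: "1 \<le> i \<Longrightarrow> i \<le> j \<Longrightarrow> j \<le> M \<Longrightarrow> v j \<le> v i"
  using anti by (auto simp: monotone_on_def)

lemma val_pos: "1 \<le> i \<Longrightarrow> i \<le> M \<Longrightarrow> 0 < v i"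
  using val_antimono[of i M] vpos by simp

lemma avg_val_ge:
  assumes "1 \<le> i" "i \<le> M"
  shows "v i \<le> avg_val v i"
proof -
  have "real i * v i = (\<Sum>l = 1..i. v i)" by simp
  also have "\<dots> \<le> (\<Sum>l = 1..i. v l)"
    using assms by (intro sum_mono val_antimono) auto
  finally show ?thesis using assms by (simp add: avg_val_def field_simps)
qed

lemma avg_val_mult: "1 \<le> i \<Longrightarrow> real i * avg_val v i = (\<Sum>l = 1..i. v l)"
  by (simp add: avg_val_def)

lemma avg_val_Suc_le:
  assumes "1 \<le> i" "Suc i \<le> M"
  shows "avg_val v (Suc i) \<le> avg_val v i"
proof -
  have "real (Suc i) * avg_val v (Suc i) = real i * avg_val v i + v (Suc i)"
    using assms by (simp only: avg_val_mult) simp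
  also have "\<dots> \<le> real (Suc i) * avg_val v i"
    using avg_val_ge[of i] val_antimono[of i "Suc i"] assms by (simp add: algebra_simps)
  finally show ?thesis by (simp add: mult_le_cancel_left del: of_nat_Suc)
qed

lemma avg_val_antimono:
  assumes "1 \<le> i" "i \<le> j" "j \<le> M"
  shows "avg_val v j \<le> avg_val v i"
  using assms(2,3)
proof (induction j rule: dec_induct)
  case (step n)
  then show ?case using avg_val_Suc_le[of n] assms(1) by simp
qed simp

lemma avg_val_gt:
  assumes "v 2 < v 1" "2 \<le> i" "i \<le> M"
  shows "v i < avg_val v i"
proof -
  have "real i * v i = (\<Sum>l = 1..i. v i)" by simp
  also have "\<dots> < (\<Sum>l = 1..i. v l)"
  proof (rule sum_strict_mono_ex1)
    show "\<forall>l\<in>{1..i}. v i \<le> v l" using assms by (auto intro: val_antimono)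
    show "\<exists>l\<in>{1..i}. v i < v l"
      using assms val_antimono[of 2 i] by (intro bexI[of _ 1]) auto
  qed simp
  finally show ?thesis using assms by (simp add: avg_val_def field_simps)
qed

text \<open>One strict drop at the start suffices: every later average includes \<open>v 1\<close>,
  hence stays strictly above the next value to be averaged in.\<close>

lemma avg_val_strict_antimono:
  assumes "v 2 < v 1" "1 \<le> i" "i < j" "j \<le> M"
  shows "avg_val v j < avg_val v i"
proof -
  have "v (Suc i) < avg_val v i"
  proof (cases "i = 1")
    case True
    then show ?thesis using assms by (simp add: avg_val_def numeral_2_eq_2)
  next
    case False
    then show ?thesis using avg_val_gt[of i] val_antimono[of i "Suc i"] assms by simp
  qed
  moreover have "real (Suc i) * avg_val v (Suc i) = real i * avg_val v i + v (Suc i)"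
    using assms by (simp only: avg_val_mult) simp
  ultimately have "real (Suc i) * avg_val v (Suc i) < real (Suc i) * avg_val v i"
    by (simp add: algebra_simps)
  then have "avg_val v (Suc i) < avg_val v i" by (simp del: of_nat_Suc)
  then show ?thesis using avg_val_antimono[of "Suc i" j] assms by simp
qed

lemma sum_val_mono: "x \<le> y \<Longrightarrow> y \<le> M \<Longrightarrow> (\<Sum>j = 1..x. v j) \<le> (\<Sum>j = 1..y. v j)"
  using val_pos by (intro sum_mono2) (auto intro: less_imp_le)

text \<open>Positive values make partial sums strictly increasing, so comparing values won amounts
  to comparing numbers of units won.\<close>

lemma sum_val_le_imp_le:
  assumes "x \<le> M" "(\<Sum>j = 1..x. v j) \<le> (\<Sum>j = 1..y. v j)"
  shows "x \<le> y"
proof (rule ccontr)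
  assume "\<not> x \<le> y"
  then have "y < x" by simp
  then have "(\<Sum>j = 1..y. v j) < (\<Sum>j = 1..x. v j)"
    using assms(1) val_pos
    by (intro sum_strict_mono2[of _ _ x]) (auto intro: less_imp_le)
  then show False using assms(2) by simp
qed

section \<open>Safety as an upper bound on each bid\<close>

lemma safe_imp_le_avg_val:
  assumes u: "uniform_strategy M m b" and "safe K v b" "M \<le> K" "l < m"
  shows "fst (b ! l) \<le> avg_val v (cum_qty b (Suc l))"
proof -
  let ?s = "bid_vector b" and ?Q = "cum_qty b (Suc l)"
  \<comment> \<open>The flood outbids every own bid and leaves exactly \<open>?Q\<close> slots, so
    the lowest winning bid is the bidder's own bid of step \<open>l\<close>.\<close>
  define \<beta> where "\<beta> = replicate (K - ?Q) (?s ! 0 + 1)"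
  have len: "length b = m" using uniform_length[OF u] .
  have Q: "0 < ?Q" using uniform_cum_qty_less[OF u, of l "Suc l"] assms(4) by simp
  have QK: "?Q \<le> K" using uniform_cum_qty_le[OF u, of "Suc l"] assms(3) by simp
  have Qs: "?Q \<le> length ?s"
    using cum_qty_mono[of "Suc l" m b] assms(4) len by (simp add: length_bid_vector)
  have srt: "?s ! j \<le> ?s ! i" if "i \<le> j" "j < length ?s" for i j
    using uniform_bid_vector_antimono[OF u] that .
  have last: "?s ! (?Q - 1) = fst (b ! l)"
    using bid_vector_last_of_step[OF u assms(4)] .
  have low: "?s ! j < ?s ! 0 + 1" if "j < length ?s" for j
    using srt[of 0 j] that by simp
  have "j < allocation K b \<beta> \<longleftrightarrow> j < ?Q" for j
    using less_allocation_iff[OF u, of j K \<beta>] low[of j] Qs QK by (auto simp: \<beta>_def)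
  then have alloc: "allocation K b \<beta> = ?Q"
    by (metis linorder_neqE_nat less_irrefl)
  have pos: "0 < ?s ! 0"
    using srt[of 0 "?Q - 1"] last uniform_pos[OF u assms(4)] Q Qs by linarith
  \<comment> \<open>The first \<open>?Q\<close> own bids and the \<open>K - ?Q\<close> flood bids
    are \<open>K\<close> bids of at least \<open>fst (b ! l)\<close>, as \<open>price_ge\<close>
    requires.\<close>
  have "{..<?Q} \<subseteq> {i. i < length ?s \<and> fst (b ! l) \<le> ?s ! i}"
    using srt[of _ "?Q - 1"] Q Qs last by auto
  then have "?Q \<le> length (filter (\<lambda>c. fst (b ! l) \<le> c) ?s)"
    using card_mono[of "{i. i < length ?s \<and> fst (b ! l) \<le> ?s ! i}" "{..<?Q}"]
    by (simp add: length_filter_conv_card)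
  moreover have "fst (b ! l) \<le> ?s ! 0 + 1"
    using low[of "?Q - 1"] last Q Qs by linarith
  ultimately have "fst (b ! l) \<le> price K b \<beta>"
    using Q QK by (intro price_ge) (auto simp: \<beta>_def)
  then have "fst (b ! l) * real ?Q \<le> payment K b \<beta>"
    by (simp add: payment_def alloc mult_right_mono)
  also have "\<dots> \<le> value_won K v b \<beta>"
    using assms(2) pos by (auto simp: safe_def competing_bids_def \<beta>_def)
  finally show ?thesis
    using Q by (simp add: value_won_def alloc avg_val_def field_simps)
qed

text \<open>If the last winning bid lies inside step \<open>l\<close>, the price is at most the
  average at the end of that step. Averages decrease, so this is at most the average over the units
  actually won.\<close>

lemma le_avg_val_imp_safe:
  assumes u: "uniform_strategy M m b"
    and le: "\<And>l. l < m \<Longrightarrow> fst (b ! l) \<le> avg_val v (cum_qty b (Suc l))"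
  shows "safe K v b"
  unfolding safe_def
proof
  fix \<beta> :: "real list"
  show "payment K b \<beta> \<le> value_won K v b \<beta>"
  proof (cases "allocation K b \<beta>")
    case 0
    then show ?thesis by (simp add: payment_def value_won_def)
  next
    case (Suc j)
    then have "j < length (bid_vector b)"
      using less_allocation_iff[OF u, of j K \<beta>] by simp
    then obtain l where l: "l < length b" "cum_qty b l \<le> j" "j < cum_qty b (Suc l)"
      by (rule bid_vector_step)
    have "price K b \<beta> \<le> fst (b ! l)"
      using price_le_last_winning_bid[OF u Suc] nth_bid_vector[OF l] by simp
    also have "\<dots> \<le> avg_val v (cum_qty b (Suc l))"
      using le l uniform_length[OF u] by simp
    also have "\<dots> \<le> avg_val v (Suc j)"
      using l uniform_cum_qty_le[OF u] by (intro avg_val_antimono) auto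
    finally have "price K b \<beta> * real (Suc j) \<le> real (Suc j) * avg_val v (Suc j)"
      by (simp add: mult.commute mult_left_mono del: of_nat_Suc)
    also have "\<dots> = (\<Sum>i = 1..Suc j. v i)"
      by (rule avg_val_mult) simp
    finally show ?thesis by (simp only: payment_def value_won_def Suc)
  qed
qed

section \<open>Raising bids, and why undominated strategies bid the averages\<close>

text \<open>With equal quantities the two bid vectors compare position by position, and a higher bid
  has no more competing bids above it.\<close>

lemma raise_bid_value_won_mono:
  assumes u: "uniform_strategy M m b" and u': "uniform_strategy M m b'"
    and cum: "\<And>l. cum_qty b' l = cum_qty b l"
    and le: "\<And>l. l < m \<Longrightarrow> fst (b ! l) \<le> fst (b' ! l)"
  shows "value_won K v b \<beta> \<le> value_won K v b' \<beta>"
proof -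
  have len: "length b = m" "length b' = m"
    using uniform_length u u' by auto
  have lenv: "length (bid_vector b') = length (bid_vector b)"
    using len cum by (simp add: length_bid_vector)
  have "j < allocation K b' \<beta>" if j: "j < allocation K b \<beta>" for j
  proof -
    have j': "j < length (bid_vector b)" "j + count_above (bid_vector b ! j) \<beta> < K"
      using j less_allocation_iff[OF u] by auto
    obtain l where l: "l < length b" "cum_qty b l \<le> j" "j < cum_qty b (Suc l)"
      using bid_vector_step[OF j'(1)] .
    have "bid_vector b ! j \<le> bid_vector b' ! j"
      using nth_bid_vector[OF l] nth_bid_vector[of l b' j] l cum len le by simp
    then have "filter (\<lambda>c. bid_vector b' ! j < c) \<beta> =
        filter (\<lambda>c. bid_vector b' ! j < c) (filter (\<lambda>c. bid_vector b ! j < c) \<beta>)"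
      by (auto intro!: filter_cong)
    then have "count_above (bid_vector b' ! j) \<beta> \<le> count_above (bid_vector b ! j) \<beta>"
      by (metis length_filter_le)
    then show ?thesis using less_allocation_iff[OF u'] j' lenv by simp
  qed
  then have "allocation K b \<beta> \<le> allocation K b' \<beta>"
    using not_le by blast
  then show ?thesis
    unfolding value_won_def using allocation_le[OF u'] by (rule sum_val_mono)
qed

lemma undominated_subset_average:
  assumes "M \<le> K"
  shows "safe_undominated_class K M v m \<subseteq> average_class M v m"
proof
  fix b assume b: "b \<in> safe_undominated_class K M v m"
  then have u: "uniform_strategy M m b" and s: "safe K v b"
    and nd: "\<not> very_weakly_dominated K v (safe_class K M v m) b"
    by (auto simp: safe_undominated_class_def safe_class_def)
  have len: "length b = m" using uniform_length[OF u] .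
  have "fst (b ! l) = avg_val v (cum_qty b (Suc l))" if l: "l < m" for l
  proof (rule ccontr)
    let ?w = "avg_val v (cum_qty b (Suc l))"
    assume "fst (b ! l) \<noteq> ?w"
    then have lt: "fst (b ! l) < ?w"
      using safe_imp_le_avg_val[OF u s assms l] by simp
    \<comment> \<open>The new bid \<open>r\<close> may reach the average without losing safety, but
      must stay below the preceding bid to keep the step structure; for \<open>l = 0\<close> there
      is no preceding bid and \<open>r\<close> can be the average itself.\<close>
    obtain r where r: "fst (b ! l) < r" "r \<le> ?w" "0 < l \<Longrightarrow> r < fst (b ! (l - 1))"
    proof (cases "l = 0")
      case True
      then show ?thesis using that lt by blast
    next
      case False
      then have "fst (b ! l) < min ?w (fst (b ! (l - 1)))"
        using lt uniform_decreasing[OF u, of "l - 1" l] l by simp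
      from dense[OF this] show ?thesis using that by auto
    qed
    define b' where "b' = b[l := (r, snd (b ! l))]"
    have len': "length b' = m" by (simp add: b'_def len)
    have nth': "b' ! k = (if k = l then (r, snd (b ! l)) else b ! k)" if "k < m" for k
      using that len by (simp add: b'_def nth_list_update)
    have "map snd b' = map snd b"
      using len len' nth' by (intro nth_equalityI) auto
    then have cum: "cum_qty b' k = cum_qty b k" for k
      by (metis cum_qty_def take_map)
    have u': "uniform_strategy M m b'"
      unfolding uniform_strategy_def
    proof (intro conjI)
      show "sorted_wrt (>) (map fst b')"
        unfolding sorted_wrt_iff_nth_less
      proof (intro allI impI)
        fix i j assume ij: "i < j" "j < length (map fst b')"
        then have jm: "j < m" using len' by simp
        have dec: "fst (b ! j) < fst (b ! i)" using uniform_decreasing[OF u ij(1) jm] .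
        \<comment> \<open>Position \<open>l\<close> remains below all earlier bids because
          \<open>r\<close> is below its predecessor, and above all later ones because the bid only
          rose.\<close>
        have "fst (b' ! j) < fst (b' ! i)"
        proof (cases "j = l")
          case True
          have "fst (b ! (l - 1)) \<le> fst (b ! i)"
            using uniform_decreasing[OF u, of i "l - 1"] ij True l
            by (cases "i = l - 1") (simp, fastforce)
          then show ?thesis using True ij nth' r l by simp
        next
          case False
          then show ?thesis using dec r ij jm nth' by auto
        qed
        then show "map fst b' ! i > map fst b' ! j" using ij by simp
      qed
      have "0 < fst (b' ! k) \<and> 0 < snd (b' ! k)" if "k < m" for k
        using that nth' uniform_pos[OF u, of k] uniform_qty_pos[OF u, of k] r by auto
      then show "\<forall>(p, q)\<in>set b'. 0 < p \<and> 0 < q"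
        using len' by (fastforce simp: in_set_conv_nth)
      show "cum_qty b' m \<le> M" using cum uniform_cum_qty_le[OF u] by simp
    qed (rule len')
    have "fst (b' ! k) \<le> avg_val v (cum_qty b' (Suc k))" if "k < m" for k
      using nth'[OF that] cum r safe_imp_le_avg_val[OF u s assms that] by auto
    then have "safe K v b'" using u' by (intro le_avg_val_imp_safe)
    moreover have "value_won K v b \<beta> \<le> value_won K v b' \<beta>" for \<beta>
      using nth' r by (intro raise_bid_value_won_mono[OF u u' cum]) auto
    moreover have "b' \<noteq> b" using nth'[OF l] r by (metis fst_conv less_irrefl)
    ultimately have "very_weakly_dominated K v (safe_class K M v m) b"
      using u' unfolding very_weakly_dominated_def safe_class_def by blast
    then show False using nd by simp
  qed
  then have "fst (b ! (l - 1)) = avg_val v (cum_qty b l)" if "l \<in> {1..m}" for l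
    using that by (cases l) auto
  then show "b \<in> average_class M v m"
    using u unfolding average_class_def by blast
qed

section \<open>Why average bids are undominated\<close>

lemma dominating_bid_ge:
  assumes u: "uniform_strategy M m b" and u': "uniform_strategy M m b'" and "M \<le> K" "l < m"
    and dom: "\<forall>\<beta> \<in> competing_bids. value_won K v b \<beta> \<le> value_won K v b' \<beta>"
  shows "cum_qty b (Suc l) \<le> length (bid_vector b')"
    and "fst (b ! l) \<le> bid_vector b' ! (cum_qty b (Suc l) - 1)"
proof -
  let ?s = "bid_vector b" and ?s' = "bid_vector b'" and ?Q = "cum_qty b (Suc l)"
  \<comment> \<open>\<open>H\<close> exceeds both bids under comparison. The position
    \<open>?Q - 1\<close> is not yet known to lie within \<open>?s'\<close>; any real value there
    serves, and the allocation of \<open>b'\<close> later shows that it is in range.\<close>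
  define H where "H = max (fst (b ! l)) (?s' ! (?Q - 1)) + 1"
  define \<beta> where "\<beta> = replicate (K - ?Q) H @ replicate ?Q (fst (b ! l))"
  have len: "length b = m" using uniform_length[OF u] .
  have pos: "0 < fst (b ! l)" using uniform_pos[OF u assms(4)] .
  have Q: "0 < ?Q" using uniform_cum_qty_less[OF u, of l "Suc l"] assms(4) by simp
  have QK: "?Q \<le> K" using uniform_cum_qty_le[OF u, of "Suc l"] assms(3) by simp
  have Qs: "?Q \<le> length ?s"
    using cum_qty_mono[of "Suc l" m b] assms(4) len by (simp add: length_bid_vector)
  have last: "?s ! (?Q - 1) = fst (b ! l)"
    using bid_vector_last_of_step[OF u assms(4)] .
  have H: "fst (b ! l) < H" "?s' ! (?Q - 1) < H"
    unfolding H_def by linarith+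
  \<comment> \<open>Only the \<open>K - ?Q\<close> bids \<open>H\<close> exceed the
    \<open>?Q\<close>-th bid of \<open>b\<close>; the copies of \<open>fst (b ! l)\<close> merely
    tie with it and lose.\<close>
  have "?Q - 1 < allocation K b \<beta>"
    using less_allocation_iff[OF u, of "?Q - 1" K \<beta>] Q Qs QK H last by (simp add: \<beta>_def)
  moreover have "\<beta> \<in> competing_bids"
    using pos H by (auto simp: competing_bids_def \<beta>_def)
  then have "allocation K b \<beta> \<le> allocation K b' \<beta>"
    using dom allocation_le[OF u] by (auto simp: value_won_def intro: sum_val_le_imp_le)
  ultimately have "?Q - 1 < allocation K b' \<beta>" by simp
  then have *: "?Q - 1 < length ?s'" "?Q - 1 + count_above (?s' ! (?Q - 1)) \<beta> < K"
    using less_allocation_iff[OF u'] by auto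
  then show "?Q \<le> length ?s'" using Q by simp
  show "fst (b ! l) \<le> ?s' ! (?Q - 1)"
  proof (rule ccontr)
    assume "\<not> ?thesis"
    \<comment> \<open>Otherwise all \<open>K\<close> competing bids, including the copies of
      \<open>fst (b ! l)\<close>, would beat the \<open>?Q\<close>-th bid of
      \<open>b'\<close>.\<close>
    then have "count_above (?s' ! (?Q - 1)) \<beta> = K"
      using H QK by (simp add: \<beta>_def)
    then show False using * by simp
  qed
qed

lemma average_subset_undominated:
  assumes "M \<le> K" and strict: "2 \<le> M \<longrightarrow> v 2 < v 1"
  shows "average_class M v m \<subseteq> safe_undominated_class K M v m"
proof
  fix b assume b: "b \<in> average_class M v m"
  then have u: "uniform_strategy M m b"
    and "\<forall>l \<in> {1..m}. fst (b ! (l - 1)) = avg_val v (cum_qty b l)"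
    by (auto simp: average_class_def)
  then have eq: "fst (b ! l) = avg_val v (cum_qty b (Suc l))" if "l < m" for l
    using that by (auto dest!: bspec[of _ _ "Suc l"])
  have len: "length b = m" using uniform_length[OF u] .
  have s: "safe K v b" using eq by (intro le_avg_val_imp_safe[OF u]) auto
  \<comment> \<open>Domination demands a different strategy, so it suffices that every safe strategy
    in the class that is at least as good equals \<open>b\<close>.\<close>
  have "b' = b" if b': "b' \<in> safe_class K M v m"
    and dom: "\<forall>\<beta> \<in> competing_bids. value_won K v b \<beta> \<le> value_won K v b' \<beta>" for b'
  proof -
    have u': "uniform_strategy M m b'" and s': "safe K v b'"
      using b' by (auto simp: safe_class_def)
    have len': "length b' = m" using uniform_length[OF u'] .
    \<comment> \<open>The end positions of the steps, from the first step on.\<close>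
    define Qs where "Qs = (\<lambda>b. map (cum_qty b) [1..<Suc m])"
    have ends: "\<exists>k<m. cum_qty b' (Suc k) = cum_qty b (Suc l) \<and> fst (b ! l) \<le> fst (b' ! k)"
      if l: "l < m" for l
    proof -
      let ?Q = "cum_qty b (Suc l)"
      have Q: "0 < ?Q" using uniform_cum_qty_less[OF u, of l "Suc l"] l by simp
      note ge = dominating_bid_ge[OF u u' assms(1) l dom]
      have "?Q - 1 < length (bid_vector b')" using ge Q by linarith
      then obtain k where k: "k < length b'" "cum_qty b' k \<le> ?Q - 1" "?Q - 1 < cum_qty b' (Suc k)"
        by (rule bid_vector_step)
      have "avg_val v ?Q \<le> fst (b' ! k)"
        using ge(2) nth_bid_vector[OF k] eq[OF l] by simp
      also have "\<dots> \<le> avg_val v (cum_qty b' (Suc k))"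
        using safe_imp_le_avg_val[OF u' s' assms(1)] k len' by simp
      finally have "\<not> avg_val v (cum_qty b' (Suc k)) < avg_val v ?Q" by simp
      \<comment> \<open>Ending later than \<open>?Q\<close> would make the average strictly smaller.
        In that case \<open>1 \<le> ?Q < cum_qty b' (Suc k) \<le> M\<close>, so
        \<open>2 \<le> M\<close> and the strict drop \<open>v 2 < v 1\<close> is available.\<close>
      then have "\<not> ?Q < cum_qty b' (Suc k)"
        using avg_val_strict_antimono[of ?Q "cum_qty b' (Suc k)"] strict Q
          uniform_cum_qty_le[OF u', of "Suc k"] by auto
      then have "cum_qty b' (Suc k) = ?Q" using k by simp
      then show ?thesis using k len' ge(2) nth_bid_vector[OF k] by auto
    qed
    have sorted: "sorted_wrt (<) (Qs c)" if "uniform_strategy M m c" for c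
      unfolding Qs_def sorted_wrt_iff_nth_less
      using uniform_cum_qty_less[OF that] by (auto simp del: upt_Suc)
    have sub: "set (Qs b) \<subseteq> set (Qs b')"
    proof
      fix x assume "x \<in> set (Qs b)"
      then obtain i where i: "1 \<le> i" "i \<le> m" "x = cum_qty b i"
        by (auto simp: Qs_def simp del: upt_Suc)
      then obtain k where "k < m" "cum_qty b' (Suc k) = x"
        using ends[of "i - 1"] by fastforce
      then show "x \<in> set (Qs b')"
        by (auto simp: Qs_def image_iff simp del: upt_Suc intro!: bexI[of _ "Suc k"])
    qed
    \<comment> \<open>Both lists increase strictly and have length \<open>m\<close>, so inclusion of
      their sets forces equality of the sets and then of the lists.\<close>
    have "card (set (Qs c)) = m" if "uniform_strategy M m c" for c
      using sorted[OF that] by (simp add: strict_sorted_iff distinct_card) (simp add: Qs_def)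
    then have "set (Qs b) = set (Qs b')"
      using sub u u' by (intro card_subset_eq) auto
    then have "Qs b = Qs b'"
      using sorted[OF u] sorted[OF u'] by (intro sorted_distinct_set_unique) (auto simp: strict_sorted_iff)
    then have cum: "cum_qty b' l = cum_qty b l" if "l \<le> m" for l
      using that by (cases "l = 0") (auto simp: Qs_def simp del: upt_Suc)
    show "b' = b"
    proof (rule nth_equalityI)
      fix l assume "l < length b'"
      then have l: "l < m" using len' by simp
      obtain k where k: "k < m" "cum_qty b' (Suc k) = cum_qty b (Suc l)" "fst (b ! l) \<le> fst (b' ! k)"
        using ends[OF l] by blast
      \<comment> \<open>Distinct steps of \<open>b'\<close> have distinct end positions. With
        \<open>k = l\<close>, domination bounds the bid of \<open>b'\<close> from below and safety
        bounds it from above.\<close>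
      have "k = l"
        using k cum[of "Suc l"] l uniform_cum_qty_less[OF u', of "Suc k" "Suc l"]
          uniform_cum_qty_less[OF u', of "Suc l" "Suc k"]
        by (cases k l rule: linorder_cases) auto
      moreover have "fst (b' ! l) \<le> fst (b ! l)"
        using safe_imp_le_avg_val[OF u' s' assms(1) l] cum[of "Suc l"] eq[OF l] l by simp
      moreover have "snd (b' ! l) = snd (b ! l)"
        using cum[of l] cum[of "Suc l"] l len len' by (simp add: cum_qty_Suc)
      ultimately show "b' ! l = b ! l" using k by (simp add: prod_eq_iff)
    qed (simp add: len len')
  qed
  then have "\<not> very_weakly_dominated K v (safe_class K M v m) b"
    by (auto simp: very_weakly_dominated_def)
  then show "b \<in> safe_undominated_class K M v m"
    using u s by (auto simp: safe_undominated_class_def safe_class_def)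
qed

end

theorem mainTheorem2:
  fixes K M m :: nat and v :: "nat \<Rightarrow> real"
  assumes "1 \<le> M" and "M \<le> K"
    and "antimono_on {1..M} v" and "0 < v M"
  shows "safe_undominated_class K M v m \<subseteq> average_class M v m \<and>
         ((2 \<le> M \<longrightarrow> v 2 < v 1) \<longrightarrow>
            safe_undominated_class K M v m = average_class M v m)"
  using undominated_subset_average[OF assms(3,4,2)] average_subset_undominated[OF assms(3,4,2)]
  by blast

end
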